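(* Let $n\ge1$ and let $w_n\in S_{n+1}$ be the permutation with $w_n(1)=1$ and $w_n(i)=n+3-i$ for $2\le i\le n+1$. For an rc-graph $D$ for $w_n$, let $\lambda(D)$ be the partition whose conjugate $\lambda'(D)$ has as its multiset of parts (discarding zeros) the numbers $i-1$, one for each $(i,j)\in E(D)$, where $E(D)$ is the set of positions of the nontrivial elbow joints of $D$. Then $D\mapsto\lambda(D)$ is a bijection from the set $\mathcal{RC}(w_n)$ of rc-graphs for $w_n$ to the set $\mathcal{DP}(n)$ of partitions whose Young diagrams fit inside the Young diagram of the staircase partition $\delta_n=(n-1,n-2,\dots,1)$.
   Context: An rc-graph for a permutation $w\in S_m$ is a filling of the upper-left half of an $m\times m$ array, i.e. of the positions $(i,j)$ (row $i$ counted from the top, column $j$ counted from the left) with $i,j\ge1$ and $i+j\le m+1$, by cross pieces and elbow joints. A cross piece lets one strand pass straight through horizontally (left edge to right edge) and another straight through vertically (bottom edge to top edge). An elbow joint connects the left edge to the top edge and the bottom edge to the right edge. Every position on the anti-diagonal $i+j=m+1$ is an elbow joint (a trivial one), of which only the strand from the left edge to the top edge is used. The filling must satisfy: for each $i$, the strand entering at the left of row $i$ exits at the top of column $w(i)$; and no two strands cross more than once (equivalently, there are exactly $\ell(w)$ cross pieces, where $\ell(w)$ is the number of inversions of $w$). $\mathcal{RC}(w)$ denotes the set of rc-graphs for $w$. For $D\in\mathcal{RC}(w_n)$ (so $m=n+1$), $E(D)$ is the set of positions $(i,j)$ with $i+j\le n+1$ at which $D$ has an elbow joint (the nontrivial elbow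 joints). $\mathcal{DP}(n)$ is the set of partitions $\lambda$ contained in $\delta_n$, i.e. with at most $n-1$ nonzero parts and $\lambda_k\le n-k$ for $1\le k\le n$. The conjugate $\lambda'$ of $\lambda$ is the partition whose $k$-th part is the number of parts of $\lambda$ that are at least $k$. *)

theory Defs
  imports "HOL-Library.Multiset" "HOL-Combinatorics.Permutations"
begin

text \<open>
  A position is a pair \<open>(i, j)\<close> of a row and a column, both numbered from 1, rows from the top.
  A filling of the triangle \<open>i + j \<le> m + 1\<close> by crosses and elbows is encoded by the set \<open>D\<close>
  of its cross positions, all other positions of the triangle being elbows.
\<close>

datatype edge = Left_Edge | Bottom_Edge

text \<open>
  \<open>strand D p i j e\<close>: the strand entering at the left of row \<open>p\<close> enters position \<open>(i, j)\<close>
  through its edge \<open>e\<close>.  The pseudo-row 0 records the exits: \<open>strand D p 0 j Bottom_Edge\<close> says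
  that the strand leaves the array at the top of column \<open>j\<close>.
\<close>

inductive strand :: "(nat \<times> nat) set \<Rightarrow> nat \<Rightarrow> nat \<Rightarrow> nat \<Rightarrow> edge \<Rightarrow> bool"
  for D :: "(nat \<times> nat) set" and p :: nat where
  enter: "strand D p p 1 Left_Edge"
| cross_horizontal:
    "strand D p (Suc i) j Left_Edge \<Longrightarrow> (Suc i, j) \<in> D \<Longrightarrow> strand D p (Suc i) (Suc j) Left_Edge"
| cross_vertical:
    "strand D p (Suc i) j Bottom_Edge \<Longrightarrow> (Suc i, j) \<in> D \<Longrightarrow> strand D p i j Bottom_Edge"
| elbow_left_top:
    "strand D p (Suc i) j Left_Edge \<Longrightarrow> (Suc i, j) \<notin> D \<Longrightarrow> strand D p i j Bottom_Edge"
| elbow_bottom_right: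
    "strand D p (Suc i) j Bottom_Edge \<Longrightarrow> (Suc i, j) \<notin> D \<Longrightarrow> strand D p (Suc i) (Suc j) Left_Edge"

definition exits_at :: "(nat \<times> nat) set \<Rightarrow> nat \<Rightarrow> nat \<Rightarrow> bool" where
  "exits_at D p j \<longleftrightarrow> strand D p 0 j Bottom_Edge"

definition crossings :: "(nat \<times> nat) set \<Rightarrow> nat \<Rightarrow> nat \<Rightarrow> (nat \<times> nat) set" where
  "crossings D p q = {(i, j). (i, j) \<in> D \<and>
     (strand D p i j Left_Edge \<and> strand D q i j Bottom_Edge \<or>
      strand D p i j Bottom_Edge \<and> strand D q i j Left_Edge)}"

text \<open>
  The bound \<open>i + j \<le> m\<close> makes every position on the anti-diagonal \<open>i + j = m + 1\<close> an elbow.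
\<close>

definition rc_graphs :: "nat \<Rightarrow> (nat \<Rightarrow> nat) \<Rightarrow> (nat \<times> nat) set set" where
  "rc_graphs m w = {D. D \<subseteq> {(i, j). 1 \<le> i \<and> 1 \<le> j \<and> i + j \<le> m} \<and>
     (\<forall>i\<in>{1..m}. exits_at D i (w i)) \<and>
     (\<forall>p\<in>{1..m}. \<forall>q\<in>{1..m}. p \<noteq> q \<longrightarrow> card (crossings D p q) \<le> 1)}"

definition w_perm :: "nat \<Rightarrow> nat \<Rightarrow> nat" where
  "w_perm n i = (if 2 \<le> i \<and> i \<le> n + 1 then n + 3 - i else i)"

lemma w_perm_permutes: "w_perm n permutes {1..n + 1}"
proof (rule bij_imp_permutes)
  show "bij_betw (w_perm n) {1..n + 1} {1..n + 1}"
    by (rule bij_betw_byWitness[where f' = "w_perm n"]) (auto simp: w_perm_def)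
qed (auto simp: w_perm_def)

definition nontrivial_elbows :: "nat \<Rightarrow> (nat \<times> nat) set \<Rightarrow> (nat \<times> nat) set" where
  "nontrivial_elbows n D = {(i, j). 1 \<le> i \<and> 1 \<le> j \<and> i + j \<le> n + 1 \<and> (i, j) \<notin> D}"

text \<open>Partitions are the weakly decreasing lists of their nonzero parts.\<close>

definition is_partition :: "nat list \<Rightarrow> bool" where
  "is_partition xs \<longleftrightarrow> sorted_wrt (\<ge>) xs \<and> (\<forall>x\<in>set xs. 0 < x)"

definition part :: "nat list \<Rightarrow> nat \<Rightarrow> nat" where
  "part xs k = (if 1 \<le> k \<and> k \<le> length xs then xs ! (k - 1) else 0)"

text \<open>
  Only the indices \<open>k\<close> up to the largest part \<open>part xs 1\<close> give a nonzero part of the conjugate.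
\<close>

definition conjugate :: "nat list \<Rightarrow> nat list" where
  "conjugate xs = map (\<lambda>k. length (filter (\<lambda>x. k \<le> x) xs)) [1..<Suc (part xs 1)]"

definition DP :: "nat \<Rightarrow> nat list set" where
  "DP n = {xs. is_partition xs \<and> length xs \<le> n - 1 \<and> (\<forall>k\<in>{1..n}. part xs k \<le> n - k)}"

text \<open>
  Conjugation is an involution on partitions, and a partition is determined by its multiset of
  parts, so the partition described below exists and is unique.
\<close>

definition rc_partition :: "nat \<Rightarrow> (nat \<times> nat) set \<Rightarrow> nat list" where
  "rc_partition n D = (THE xs. is_partition xs \<and>
     mset (conjugate xs) =
       filter_mset (\<lambda>x. 0 < x) (image_mset (\<lambda>(i, j). i - 1) (mset_set (nontrivial_elbows n D))))"

end

theory Submission imports Defs begin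

text \<open>
  The elbows of an rc-graph for \<open>w\<^sub>n\<close> form a triangulation of an \<open>(n+2)\<close>-gon, the elbow at \<open>(i, j)\<close>
  being the diagonal (or the edge, if \<open>i = j = 1\<close>) from \<open>i\<close> to \<open>n + 3 - j\<close>; the proof cuts off ears.
  If \<open>k\<close> is the last row with a nontrivial elbow, then \<open>(k, n + 1 - k)\<close> is an elbow, and strand
  \<open>k + 1\<close> runs through row \<open>k + 1\<close> and column \<open>n + 2 - k\<close>, which consist of crosses.  Deleting this
  row and column leaves an rc-graph for \<open>w\<^bsub>n-1\<^esub>\<close>, and the multiset of the numbers \<open>i - 1\<close> loses one
  copy of its maximum \<open>k - 1\<close>.  As \<open>k\<close> can be read off the multiset, the step is reversible, and by
  induction the multisets that occur are exactly those with at most \<open>n - i\<close> parts \<open>\<ge> i\<close> for every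
  \<open>i \<ge> 1\<close>, which are the conjugates of the partitions in \<open>DP n\<close>.
\<close>

subsection \<open>Strands as paths\<close>

text \<open>The rules of \<open>strand\<close> are deterministic; iterating this function lists the
  states of a strand in time order. Exit states in row 0 are fixed points, so the iteration never
  has to stop.\<close>

fun advance :: "(nat \<times> nat) set \<Rightarrow> nat \<times> nat \<times> edge \<Rightarrow> nat \<times> nat \<times> edge" where
  "advance D (0, j, e) = (0, j, e)"
| "advance D (Suc i, j, Left_Edge) =
    (if (Suc i, j) \<in> D then (Suc i, Suc j, Left_Edge) else (i, j, Bottom_Edge))"
| "advance D (Suc i, j, Bottom_Edge) =
    (if (Suc i, j) \<in> D then (i, j, Bottom_Edge) else (Suc i, Suc j, Left_Edge))"

lemma strand_imp_advance:
  "strand D p i j e \<Longrightarrow> \<exists>t. (advance D ^^ t) (p, 1, Left_Edge) = (i, j, e)"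
proof (induction rule: strand.induct)
  case enter
  show ?case by (rule exI[of _ 0]) simp
next
  case (cross_horizontal i j)
  then obtain t where "(advance D ^^ t) (p, 1, Left_Edge) = (Suc i, j, Left_Edge)" by blast
  with cross_horizontal show ?case by (intro exI[of _ "Suc t"]) simp
next
  case (cross_vertical i j)
  then obtain t where "(advance D ^^ t) (p, 1, Left_Edge) = (Suc i, j, Bottom_Edge)" by blast
  with cross_vertical show ?case by (intro exI[of _ "Suc t"]) simp
next
  case (elbow_left_top i j)
  then obtain t where "(advance D ^^ t) (p, 1, Left_Edge) = (Suc i, j, Left_Edge)" by blast
  with elbow_left_top show ?case by (intro exI[of _ "Suc t"]) simp
next
  case (elbow_bottom_right i j)
  then obtain t where "(advance D ^^ t) (p, 1, Left_Edge) = (Suc i, j, Bottom_Edge)" by blast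
  with elbow_bottom_right show ?case by (intro exI[of _ "Suc t"]) simp
qed

text \<open>An invariant of iterated \<open>advance\<close>, weaker than reachability. Paths move
  only up and right; the last two clauses say that a strand enters a row from below, and a column
  from the left, only once.\<close>

definition later :: "nat \<times> nat \<times> edge \<Rightarrow> nat \<times> nat \<times> edge \<Rightarrow> bool" where
  "later = (\<lambda>(i, j, e) (i', j', e'). i' \<le> i \<and> j \<le> j' \<and>
     (e = Bottom_Edge \<and> i' = i \<longrightarrow> e' = Left_Edge \<or> j' = j) \<and>
     (e = Left_Edge \<and> j' = j \<longrightarrow> e' = Bottom_Edge \<or> i' = i))"

lemma later_advance: "later s s' \<Longrightarrow> later s (advance D s')"
  by (cases "(D, s')" rule: advance.cases; cases s) (auto simp: later_def)

lemma later_funpow_advance: "later s ((advance D ^^ t) s)"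
proof (induction t)
  case 0
  show ?case by (cases s) (simp add: later_def)
qed (simp add: later_advance)

text \<open>Both states lie on the orbit of \<open>advance\<close> that starts at the entry of
  strand \<open>p\<close>, so one of them is an iterate of the other.\<close>

lemma strand_comparable:
  assumes "strand D p i j e" "strand D p i' j' e'"
  shows "later (i, j, e) (i', j', e') \<or> later (i', j', e') (i, j, e)"
proof -
  obtain t t' where t: "(advance D ^^ t) (p, 1, Left_Edge) = (i, j, e)"
    and t': "(advance D ^^ t') (p, 1, Left_Edge) = (i', j', e')"
    using assms strand_imp_advance by blast
  have *: "later ((advance D ^^ a) s) ((advance D ^^ b) s)" if "a \<le> b" for a b s
  proof -
    from that have "(advance D ^^ b) s = (advance D ^^ (b - a)) ((advance D ^^ a) s)"
      by (metis add_diff_cancel_left' comp_apply funpow_add le_add_diff_inverse2)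
    thus ?thesis by (simp add: later_funpow_advance)
  qed
  show ?thesis using *[of t t'] *[of t' t] t t' by (metis nle_le)
qed

lemma strand_bottom_unique:
  "strand D p i j Bottom_Edge \<Longrightarrow> strand D p i j' Bottom_Edge \<Longrightarrow> j = j'"
  by (drule (1) strand_comparable) (auto simp: later_def)

lemma strand_left_unique:
  "strand D p i j Left_Edge \<Longrightarrow> strand D p i' j Left_Edge \<Longrightarrow> i = i'"
  by (drule (1) strand_comparable) (auto simp: later_def)

text \<open>Columns never decrease in time, and an exit in row 0 cannot precede a state in a
  positive row. This is how prescribed exits restrict the paths of strands.\<close>

lemma strand_column_le_exit:
  "strand D p i j e \<Longrightarrow> exits_at D p j' \<Longrightarrow> 0 < i \<Longrightarrow> j \<le> j'"
  unfolding exits_at_def by (drule (1) strand_comparable) (auto simp: later_def)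

lemma strand_row_le: "strand D p i j e \<Longrightarrow> i \<le> p"
  by (induction rule: strand.induct) auto

lemma strand_along_row:
  assumes "1 \<le> p" "1 \<le> c" "\<And>j. 1 \<le> j \<Longrightarrow> j < c \<Longrightarrow> (p, j) \<in> D"
  shows "strand D p p c Left_Edge"
  using assms(2,3)
proof (induction c rule: dec_induct)
  case base
  show ?case by (rule strand.enter)
next
  case (step c)
  obtain i where "p = Suc i" using assms(1) by (cases p) auto
  with step show ?case using strand.cross_horizontal[of D p i c] by simp
qed

lemma strand_along_column:
  assumes "strand D p i0 c Bottom_Edge" "i \<le> i0" "\<And>a. i < a \<Longrightarrow> a \<le> i0 \<Longrightarrow> (a, c) \<in> D"
  shows "strand D p i c Bottom_Edge"
  using assms(2,1,3)
proof (induction i rule: inc_induct)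
  case (step i)
  hence "strand D p (Suc i) c Bottom_Edge" by simp
  with step show ?case using strand.cross_vertical by simp
qed

section \<open>Triangular arrays\<close>

definition triangle :: "nat \<Rightarrow> (nat \<times> nat) set" where
  "triangle m = {(i, j). 1 \<le> i \<and> 1 \<le> j \<and> i + j \<le> m}"

lemma finite_triangle: "finite (triangle m)"
  by (rule finite_subset[of _ "{..m} \<times> {..m}"]) (auto simp: triangle_def)

text \<open>Steps to the right start at a cross or at an elbow entered from below, where
  \<open>i + j \<le> m\<close>; upward steps lower \<open>i + j\<close>. So the anti-diagonal is
  reached only from the left.\<close>

lemma strand_in_triangle:
  assumes D: "D \<subseteq> triangle m" and "strand D p i j e" "1 \<le> p" "p \<le> m"
  shows "1 \<le> j \<and> i + j \<le> Suc m \<and> (i + j = Suc m \<longrightarrow> e = Left_Edge)"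
  using assms(2-)
  by (induction rule: strand.induct) (use D in \<open>auto simp: triangle_def\<close>)

lemma rc_graphs_triangle:
  "D \<in> rc_graphs m w \<longleftrightarrow> D \<subseteq> triangle m \<and>
     (\<forall>i\<in>{1..m}. exits_at D i (w i)) \<and>
     (\<forall>p\<in>{1..m}. \<forall>q\<in>{1..m}. p \<noteq> q \<longrightarrow> card (crossings D p q) \<le> 1)"
  unfolding rc_graphs_def triangle_def by auto

lemma crossings_subset: "crossings D p q \<subseteq> D"
  by (auto simp: crossings_def)

lemma crossings_commute: "crossings D p q = crossings D q p"
  by (auto simp: crossings_def)

subsection \<open>Inserting an ear\<close>

text \<open>The renumbering caused by a new index \<open>Suc a\<close>: the increasing map whose
  image omits exactly \<open>Suc a\<close>.\<close>

definition shift :: "nat \<Rightarrow> nat \<Rightarrow> nat" where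
  "shift a i = (if i \<le> a then i else Suc i)"

lemma shift_eq_iff [simp]: "shift a i = shift a i' \<longleftrightarrow> i = i'"
  by (auto simp: shift_def)

lemma shift_neq [simp]: "shift a i \<noteq> Suc a" "Suc a \<noteq> shift a i"
  by (auto simp: shift_def)

lemma shift_Suc: obtains i' where "shift a (Suc i) = Suc i'"
  by (cases "Suc i \<le> a") (auto simp: shift_def)

lemma shift_cases:
  obtains "i = Suc a" | i' where "i = shift a i'"
proof (cases "i \<le> a")
  case True
  thus ?thesis using that(2)[of i] by (simp add: shift_def)
next
  case False
  show ?thesis
  proof (cases "i = Suc a")
    case True
    thus ?thesis using that by simp
  next
    case False
    thus ?thesis using that(2)[of "i - 1"] \<open>\<not> i \<le> a\<close> by (simp add: shift_def)
  qed
qed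

text \<open>Deleting one entry of the decreasing part of the permutation and renumbering leaves a
  permutation of the same shape. The fixed point 1 survives because
  \<open>k \<ge> 1\<close>.\<close>

lemma w_perm_shift:
  assumes "1 \<le> k" "k \<le> n + 1" "1 \<le> p" "p \<le> n + 1"
  shows "w_perm (n + 1) (shift k p) = shift (n + 2 - k) (w_perm n p)"
  using assms by (auto simp: w_perm_def shift_def)

lemma w_perm_new: "1 \<le> k \<Longrightarrow> k \<le> n + 1 \<Longrightarrow> w_perm (n + 1) (Suc k) = Suc (n + 2 - k)"
  by (auto simp: w_perm_def)

lemma strand_numbers:
  assumes "k \<le> n + 1"
  shows "{1..n + 2} = insert (Suc k) (shift k ` {1..n + 1})"
proof (intro equalityI subsetI)
  fix x assume x: "x \<in> {1..n + 2}"
  show "x \<in> insert (Suc k) (shift k ` {1..n + 1})"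
  proof (cases x rule: shift_cases[of _ k])
    case (2 p)
    hence "p \<in> {1..n + 1}" using x assms by (auto simp: shift_def split: if_splits)
    with 2 show ?thesis by auto
  qed auto
qed (use assms in \<open>auto simp: shift_def\<close>)

text \<open>The new row \<open>Suc k\<close> and new column \<open>Suc (n + 2 - k)\<close> hold
  crosses up to just before the ear's neighbours \<open>(Suc k, n + 2 - k)\<close> and
  \<open>(k, Suc (n + 2 - k))\<close> on the new anti-diagonal. The ear
  \<open>(k, n + 2 - k)\<close> itself lies on the old anti-diagonal.\<close>

definition insert_ear :: "nat \<Rightarrow> nat \<Rightarrow> (nat \<times> nat) set \<Rightarrow> (nat \<times> nat) set" where
  "insert_ear n k D = (\<lambda>(i, j). (shift k i, shift (n + 2 - k) j)) ` D
     \<union> {(Suc k, j) | j. 1 \<le> j \<and> j + k \<le> n + 1}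
     \<union> {(i, Suc (n + 2 - k)) | i. 1 \<le> i \<and> i < k}"

section \<open>Strands, crossings and elbows after the insertion\<close>

context
  fixes n k :: nat and D :: "(nat \<times> nat) set"
  assumes k: "1 \<le> k" "k \<le> n + 1" and D: "D \<subseteq> triangle (n + 1)"
begin

lemma insert_ear_iff:
  "(shift k i, shift (n + 2 - k) j) \<in> insert_ear n k D \<longleftrightarrow> (i, j) \<in> D"
  "(Suc k, j) \<in> insert_ear n k D \<longleftrightarrow> 1 \<le> j \<and> j + k \<le> n + 1"
  "(i, Suc (n + 2 - k)) \<in> insert_ear n k D \<longleftrightarrow> 1 \<le> i \<and> i < k"
  using k by (auto simp: insert_ear_def)

lemma insert_ear_triangle: "insert_ear n k D \<subseteq> triangle (n + 2)"
proof -
  have "(shift k i, shift (n + 2 - k) j) \<in> triangle (n + 2)" if "(i, j) \<in> D" for i j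
    using that D k by (auto simp: triangle_def shift_def split: if_splits)
  thus ?thesis using k by (auto simp: insert_ear_def triangle_def)
qed

text \<open>A step to the right may land in the inserted column. Then
  \<open>i + j \<le> n + 1\<close> forces \<open>i < k\<close>, where that column has a cross that
  the strand passes horizontally.\<close>

lemma insert_ear_right:
  assumes "strand (insert_ear n k D) p (shift k i) (Suc (shift (n + 2 - k) j)) Left_Edge"
    and "1 \<le> i" "i + j \<le> n + 1"
  shows "strand (insert_ear n k D) p (shift k i) (shift (n + 2 - k) (Suc j)) Left_Edge"
proof (cases "j = n + 2 - k")
  case True
  with assms k have "i < k" by auto
  hence "shift k i = Suc (i - 1)" "(i, Suc (n + 2 - k)) \<in> insert_ear n k D"
    using assms insert_ear_iff(3) by (auto simp: shift_def)
  with assms True show ?thesis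
    using strand.cross_horizontal[of "insert_ear n k D" p "i - 1"] by (simp add: shift_def)
qed (use assms in \<open>auto simp: shift_def split: if_splits\<close>)

text \<open>The mirror image for upward steps: a strand landing in the inserted row does so left of
  the anti-diagonal and passes a cross vertically.\<close>

lemma insert_ear_up:
  assumes "strand (insert_ear n k D) p i' (shift (n + 2 - k) j) Bottom_Edge"
    and "Suc i' = shift k (Suc i)" "1 \<le> j" "i + j \<le> n + 1"
  shows "strand (insert_ear n k D) p (shift k i) (shift (n + 2 - k) j) Bottom_Edge"
proof (cases "i = k")
  case True
  with assms have "j \<le> n + 2 - k" by auto
  hence "shift (n + 2 - k) j = j" "i' = Suc k" "(Suc k, j) \<in> insert_ear n k D"
    using assms True insert_ear_iff(2) by (auto simp: shift_def)
  with assms True show ?thesis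
    using strand.cross_vertical[of "insert_ear n k D" p k j] by (simp add: shift_def)
qed (use assms in \<open>auto simp: shift_def split: if_splits\<close>)

text \<open>Each old step is repeated in the larger array, followed by a straight pass through the
  inserted row or column if it lands there.\<close>

lemma strand_insert_ear:
  assumes "strand D p i j e" "1 \<le> p" "p \<le> n + 1"
  shows "strand (insert_ear n k D) (shift k p) (shift k i) (shift (n + 2 - k) j) e"
  using assms(1)
proof (induction rule: strand.induct)
  case enter
  have "shift (n + 2 - k) 1 = 1" using k by (simp add: shift_def)
  thus ?case using strand.enter by simp
next
  case (cross_horizontal i j)
  have "Suc i + j \<le> n + 1" using cross_horizontal D by (auto simp: triangle_def)
  moreover obtain i' where "shift k (Suc i) = Suc i'" by (rule shift_Suc)
  ultimately show ?case using cross_horizontal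
    insert_ear_right[of "shift k p" "Suc i" j] insert_ear_iff(1)[of "Suc i" j]
    strand.cross_horizontal[of "insert_ear n k D" "shift k p" i' "shift (n + 2 - k) j"] by simp
next
  case (cross_vertical i j)
  have "Suc i + j \<le> n + 1" "1 \<le> j" using cross_vertical D by (auto simp: triangle_def)
  moreover obtain i' where "shift k (Suc i) = Suc i'" by (rule shift_Suc)
  ultimately show ?case using cross_vertical
    insert_ear_up[of "shift k p" i' j i] insert_ear_iff(1)[of "Suc i" j]
    strand.cross_vertical[of "insert_ear n k D" "shift k p" i' "shift (n + 2 - k) j"] by simp
next
  case (elbow_left_top i j)
  have "Suc i + j \<le> n + 2" "1 \<le> j"
    using strand_in_triangle[OF D elbow_left_top(1)] assms by auto
  moreover obtain i' where "shift k (Suc i) = Suc i'" by (rule shift_Suc)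
  ultimately show ?case using elbow_left_top
    insert_ear_up[of "shift k p" i' j i] insert_ear_iff(1)[of "Suc i" j]
    strand.elbow_left_top[of "insert_ear n k D" "shift k p" i' "shift (n + 2 - k) j"] by simp
next
  case (elbow_bottom_right i j)
  have "Suc i + j \<le> n + 1"
    using strand_in_triangle[OF D elbow_bottom_right(1)] assms by auto
  moreover obtain i' where "shift k (Suc i) = Suc i'" by (rule shift_Suc)
  ultimately show ?case using elbow_bottom_right
    insert_ear_right[of "shift k p" "Suc i" j] insert_ear_iff(1)[of "Suc i" j]
    strand.elbow_bottom_right[of "insert_ear n k D" "shift k p" i' "shift (n + 2 - k) j"] by simp
qed

text \<open>Strands other than the new one run straight through the inserted row and column, so the
  states there are the successors, respectively predecessors, of states in the old array.\<close>

definition contracted :: "nat \<Rightarrow> nat \<Rightarrow> nat \<Rightarrow> edge \<Rightarrow> bool" where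
  "contracted p i j e \<longleftrightarrow>
    (\<forall>i' j'. i = shift k i' \<longrightarrow> j = shift (n + 2 - k) j' \<longrightarrow> strand D p i' j' e) \<and>
    (i = Suc k \<longrightarrow> e = Bottom_Edge \<and> j \<le> n + 1 - k \<and> strand D p k j Bottom_Edge) \<and>
    (j = Suc (n + 2 - k) \<longrightarrow> e = Left_Edge \<and> i < k \<and> strand D p i j Left_Edge)"

lemma contracted_old:
  assumes "strand D p i j e" "1 \<le> p" "p \<le> n + 1"
  shows "contracted p (shift k i) (shift (n + 2 - k) j) e"
  using assms by (auto simp: contracted_def)

lemma contracted_right:
  assumes "strand D p i (Suc j) Left_Edge" "i + j \<le> n + 1" "1 \<le> p" "p \<le> n + 1"
  shows "contracted p (shift k i) (Suc (shift (n + 2 - k) j)) Left_Edge"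
proof (cases "j = n + 2 - k")
  case True
  with assms k have "i < k" by auto
  with assms True show ?thesis by (auto simp: contracted_def shift_def)
next
  case False
  hence "Suc (shift (n + 2 - k) j) = shift (n + 2 - k) (Suc j)" by (auto simp: shift_def)
  with assms contracted_old show ?thesis by metis
qed

lemma contracted_up:
  assumes "strand D p i j Bottom_Edge" "i + j \<le> n + 1" "1 \<le> p" "p \<le> n + 1"
    and "Suc i' = shift k (Suc i)"
  shows "contracted p i' (shift (n + 2 - k) j) Bottom_Edge"
proof (cases "i = k")
  case True
  with assms have "i' = Suc k" "j \<le> n + 1 - k" by (auto simp: shift_def)
  with assms True show ?thesis by (auto simp: contracted_def shift_def)
next
  case False
  hence "i' = shift k i" using assms by (auto simp: shift_def split: if_splits)
  with assms contracted_old show ?thesis by metis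
qed

text \<open>The converse simulation: \<open>contracted\<close> is preserved by every step of an old
  strand in the larger array, so only images of old states and straight passes occur.\<close>

lemma strand_insert_ear_contracted:
  assumes "strand (insert_ear n k D) (shift k p) i j e" "1 \<le> p" "p \<le> n + 1"
  shows "contracted p i j e"
  using assms(1)
proof (induction rule: strand.induct)
  case enter
  have "shift (n + 2 - k) 1 = 1" using k by (simp add: shift_def)
  thus ?case using contracted_old[OF strand.enter] assms by metis
next
  case (cross_horizontal i j)
  have "Suc i \<noteq> Suc k" using cross_horizontal by (auto simp: contracted_def)
  then obtain i' where i': "Suc i = shift k i'" by (metis shift_cases)
  show ?case
  proof (cases j rule: shift_cases[of _ "n + 2 - k"])
    case 1
    with cross_horizontal have s: "strand D p (Suc i) (Suc (n + 2 - k)) Left_Edge" "Suc i < k"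
      by (auto simp: contracted_def)
    with 1 contracted_old[OF s(1)] assms show ?thesis by (simp add: shift_def)
  next
    case (2 j')
    with cross_horizontal i' have s: "strand D p i' j' Left_Edge" "(i', j') \<in> D"
      using insert_ear_iff(1) by (auto simp: contracted_def)
    hence "i' + j' \<le> n + 1" "1 \<le> i'" using D by (auto simp: triangle_def)
    with s strand.cross_horizontal[of D p "i' - 1" j'] have "strand D p i' (Suc j') Left_Edge"
      by simp
    with contracted_right \<open>i' + j' \<le> n + 1\<close> assms i' 2 show ?thesis by simp
  qed
next
  case (cross_vertical i j)
  have "j \<noteq> Suc (n + 2 - k)" using cross_vertical by (auto simp: contracted_def)
  then obtain j' where j': "j = shift (n + 2 - k) j'" by (metis shift_cases)
  show ?case
  proof (cases "Suc i" rule: shift_cases[of _ k])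
    case 1
    with cross_vertical have s: "strand D p k j Bottom_Edge" "j \<le> n + 1 - k"
      by (auto simp: contracted_def)
    hence "shift k k = k" "shift (n + 2 - k) j = j" "i = k" using 1 by (auto simp: shift_def)
    with contracted_old[OF s(1)] assms show ?thesis by metis
  next
    case (2 i')
    with cross_vertical j' have s: "strand D p i' j' Bottom_Edge" "(i', j') \<in> D"
      using insert_ear_iff(1) by (auto simp: contracted_def)
    hence "i' + j' \<le> n + 1" "1 \<le> i'" using D by (auto simp: triangle_def)
    with s strand.cross_vertical[of D p "i' - 1" j'] have "strand D p (i' - 1) j' Bottom_Edge"
      by simp
    with contracted_up[of p "i' - 1" j' i] \<open>i' + j' \<le> n + 1\<close> \<open>1 \<le> i'\<close> assms j' 2
    show ?thesis by simp
  qed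
next
  case (elbow_left_top i j)
  have "Suc i \<noteq> Suc k" using elbow_left_top by (auto simp: contracted_def)
  then obtain i' where i': "Suc i = shift k i'" by (metis shift_cases)
  have "j \<noteq> Suc (n + 2 - k)"
    using elbow_left_top insert_ear_iff(3)[of "Suc i"] by (auto simp: contracted_def)
  then obtain j' where j': "j = shift (n + 2 - k) j'" by (metis shift_cases)
  have s: "strand D p i' j' Left_Edge" "(i', j') \<notin> D"
    using elbow_left_top i' j' insert_ear_iff(1) by (auto simp: contracted_def)
  have "i' + j' \<le> n + 2" using strand_in_triangle[OF D s(1)] assms by auto
  have "1 \<le> i'" using i' by (cases i') (auto simp: shift_def)
  with s strand.elbow_left_top[of D p "i' - 1" j'] have "strand D p (i' - 1) j' Bottom_Edge"
    by simp
  with contracted_up[of p "i' - 1" j' i] \<open>i' + j' \<le> n + 2\<close> \<open>1 \<le> i'\<close> assms i' j'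
  show ?case by simp
next
  case (elbow_bottom_right i j)
  have "j \<noteq> Suc (n + 2 - k)" using elbow_bottom_right by (auto simp: contracted_def)
  then obtain j' where j': "j = shift (n + 2 - k) j'" by (metis shift_cases)
  \<comment> \<open>The invariant confines the strand to columns up to \<open>n + 1 - k\<close>,
    where the inserted row has crosses and no elbow.\<close>
  have "Suc i \<noteq> Suc k"
  proof
    assume "Suc i = Suc k"
    hence "strand D p k j Bottom_Edge" "j \<le> n + 1 - k" "(Suc k, j) \<notin> insert_ear n k D"
      using elbow_bottom_right by (auto simp: contracted_def)
    with strand_in_triangle[OF D] assms k insert_ear_iff(2)[of j] show False by force
  qed
  then obtain i' where i': "Suc i = shift k i'" by (metis shift_cases)
  have s: "strand D p i' j' Bottom_Edge" "(i', j') \<notin> D"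
    using elbow_bottom_right i' j' insert_ear_iff(1) by (auto simp: contracted_def)
  have "i' + j' \<le> n + 1" using strand_in_triangle[OF D s(1)] assms by force
  have "1 \<le> i'" using i' by (cases i') (auto simp: shift_def)
  with s strand.elbow_bottom_right[of D p "i' - 1" j'] have "strand D p i' (Suc j') Left_Edge"
    by simp
  with contracted_right \<open>i' + j' \<le> n + 1\<close> assms i' j' show ?case by simp
qed

lemma strand_insert_ear_iff:
  assumes "1 \<le> p" "p \<le> n + 1"
  shows "strand (insert_ear n k D) (shift k p) (shift k i) (shift (n + 2 - k) j) e
    \<longleftrightarrow> strand D p i j e"
  using strand_insert_ear strand_insert_ear_contracted assms
  unfolding contracted_def by blast

lemma exits_at_insert_ear_iff:
  assumes "1 \<le> p" "p \<le> n + 1"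
  shows "exits_at (insert_ear n k D) (shift k p) (shift (n + 2 - k) j) \<longleftrightarrow> exits_at D p j"
  using strand_insert_ear_iff[OF assms, of 0] by (simp add: exits_at_def shift_def)

text \<open>Old strands enter the inserted row only from below and the inserted column only from the
  left, so no two of them cross there.\<close>

lemma crossings_insert_ear:
  assumes "1 \<le> p" "p \<le> n + 1" "1 \<le> q" "q \<le> n + 1"
  shows "crossings (insert_ear n k D) (shift k p) (shift k q) =
    (\<lambda>(i, j). (shift k i, shift (n + 2 - k) j)) ` crossings D p q"
proof (intro equalityI subsetI)
  fix x assume "x \<in> crossings (insert_ear n k D) (shift k p) (shift k q)"
  then obtain i j e f where x: "x = (i, j)" "(i, j) \<in> insert_ear n k D"
    and s: "strand (insert_ear n k D) (shift k p) i j e"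
      "strand (insert_ear n k D) (shift k q) i j f"
    and ef: "e \<noteq> f" "e = Left_Edge \<or> e = Bottom_Edge" "f = Left_Edge \<or> f = Bottom_Edge"
    by (auto simp: crossings_def)
  have c: "contracted p i j e" "contracted q i j f"
    using s strand_insert_ear_contracted assms by auto
  hence "i \<noteq> Suc k" "j \<noteq> Suc (n + 2 - k)" using ef by (auto simp: contracted_def)
  then obtain i' j' where ij: "i = shift k i'" "j = shift (n + 2 - k) j'"
    by (metis shift_cases)
  have "(i', j') \<in> crossings D p q"
    using c ef x ij insert_ear_iff(1) by (auto simp: contracted_def crossings_def)
  thus "x \<in> (\<lambda>(i, j). (shift k i, shift (n + 2 - k) j)) ` crossings D p q"
    using x ij by auto
qed (use assms in \<open>auto simp: crossings_def strand_insert_ear_iff[simplified] insert_ear_iff[simplified]\<close>)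

lemma card_crossings_insert_ear:
  assumes "1 \<le> p" "p \<le> n + 1" "1 \<le> q" "q \<le> n + 1"
  shows "card (crossings (insert_ear n k D) (shift k p) (shift k q)) = card (crossings D p q)"
  unfolding crossings_insert_ear[OF assms] by (rule card_image) (auto simp: inj_on_def)

text \<open>The disjuncts follow the new strand in time: right along its row, up into the ear, right
  out of the ear, and up the inserted column.\<close>

lemma new_strand_positions:
  assumes "strand (insert_ear n k D) (Suc k) i j e"
  shows "i = Suc k \<and> 1 \<le> j \<and> j \<le> n + 2 - k \<and> e = Left_Edge \<or>
    i = k \<and> j = n + 2 - k \<and> e = Bottom_Edge \<or>
    i = k \<and> j = Suc (n + 2 - k) \<and> e = Left_Edge \<or>
    i < k \<and> j = Suc (n + 2 - k) \<and> e = Bottom_Edge"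
  using assms
proof (induction rule: strand.induct)
  case enter
  show ?case using k by auto
next
  case (cross_horizontal i j)
  thus ?case using insert_ear_iff(2)[of j] insert_ear_iff(3)[of k] k by auto
next
  case (cross_vertical i j)
  \<comment> \<open>The ear is fixed by the renumbering and lies on the old anti-diagonal, which
    \<open>D\<close> avoids.\<close>
  have "(k, n + 2 - k) \<notin> insert_ear n k D"
    using insert_ear_iff(1)[of k "n + 2 - k"] D k by (auto simp: shift_def triangle_def)
  with cross_vertical show ?case by auto
next
  case (elbow_left_top i j)
  thus ?case using insert_ear_iff(2)[of j] k by auto
next
  case (elbow_bottom_right i j)
  thus ?case using insert_ear_iff(3)[of "Suc i"] k by auto
qed

lemma new_strand_exits: "exits_at (insert_ear n k D) (Suc k) (Suc (n + 2 - k))"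
proof -
  let ?E = "insert_ear n k D"
  have "strand ?E (Suc k) (Suc k) (n + 2 - k) Left_Edge"
    by (rule strand_along_row) (use k insert_ear_iff(2) in auto)
  moreover have "(Suc k, n + 2 - k) \<notin> ?E" using insert_ear_iff(2) k by auto
  ultimately have "strand ?E (Suc k) k (n + 2 - k) Bottom_Edge" by (rule strand.elbow_left_top)
  moreover have "(k, n + 2 - k) \<notin> ?E"
    using insert_ear_iff(1)[of k "n + 2 - k"] D k by (auto simp: shift_def triangle_def)
  ultimately have "strand ?E (Suc k) k (Suc (n + 2 - k)) Left_Edge"
    using strand.elbow_bottom_right[of ?E "Suc k" "k - 1"] k by simp
  moreover have "(k, Suc (n + 2 - k)) \<notin> ?E" using insert_ear_iff(3) by auto
  ultimately have "strand ?E (Suc k) (k - 1) (Suc (n + 2 - k)) Bottom_Edge"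
    using strand.elbow_left_top[of ?E "Suc k" "k - 1"] k by simp
  thus ?thesis unfolding exits_at_def
    by (rule strand_along_column) (use insert_ear_iff(3) in auto)
qed

text \<open>The inserted row and the inserted column are each crossed at most once by a given strand.
  A strand crossing the row starts below it, hence exits to the left of the column.\<close>

lemma card_crossings_new_strand:
  assumes q: "1 \<le> q" "q \<noteq> Suc k"
    and exit: "exits_at (insert_ear n k D) q c" "Suc k < q \<Longrightarrow> c \<le> n + 2 - k"
  shows "card (crossings (insert_ear n k D) (Suc k) q) \<le> 1"
proof -
  let ?E = "insert_ear n k D"
  \<comment> \<open>\<open>?R\<close> and \<open>?C\<close> cover the crossings in the inserted row
    and column and mention only strand \<open>q\<close>, so uniqueness of its states
    applies.\<close>
  let ?R = "\<lambda>(i, j). i = Suc k \<and> strand ?E q (Suc k) j Bottom_Edge"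
  let ?C = "\<lambda>(i, j). 1 \<le> i \<and> j = Suc (n + 2 - k) \<and> strand ?E q i j Left_Edge"
  have cases: "?R x \<or> ?C x" if "x \<in> crossings ?E (Suc k) q" for x
  proof -
    obtain i j where x: "x = (i, j)" by (cases x)
    have "1 \<le> i" using that x crossings_subset insert_ear_triangle by (force simp: triangle_def)
    moreover have "(k, n + 2 - k) \<notin> ?E"
      using insert_ear_iff(1)[of k "n + 2 - k"] D k by (auto simp: shift_def triangle_def)
    moreover have "(k, Suc (n + 2 - k)) \<notin> ?E" using insert_ear_iff(3) by auto
    ultimately show ?thesis using that x new_strand_positions by (fastforce simp: crossings_def)
  qed
  have "False" if xy: "?R x" "?C y" for x y
  proof -
    obtain j where j: "strand ?E q (Suc k) j Bottom_Edge"
      using xy(1) by (cases x) auto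
    obtain i where i: "1 \<le> i" "strand ?E q i (Suc (n + 2 - k)) Left_Edge"
      using xy(2) by (cases y) auto
    have "Suc k < q" using strand_row_le[OF j] q by auto
    moreover have "Suc (n + 2 - k) \<le> c" using strand_column_le_exit[OF i(2) exit(1)] i by auto
    ultimately show False using exit(2) by auto
  qed
  moreover have "x = y" if "?R x" "?R y" for x y
    using that strand_bottom_unique by (cases x; cases y) auto
  moreover have "x = y" if "?C x" "?C y" for x y
    using that strand_left_unique by (cases x; cases y) auto
  ultimately have *: "x = y" if "x \<in> crossings ?E (Suc k) q" "y \<in> crossings ?E (Suc k) q" for x y
    using cases that by meson
  have "finite (crossings ?E (Suc k) q)"
    using crossings_subset insert_ear_triangle finite_triangle finite_subset by metis
  with * show ?thesis by (simp add: card_le_Suc0_iff_eq)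
qed

text \<open>Exits and mutual crossings of old strands transfer both ways. The new strand always
  exits correctly, and its crossings are controlled by the exits of the others.\<close>

lemma insert_ear_rc_graph_iff:
  "insert_ear n k D \<in> rc_graphs (n + 2) (w_perm (n + 1)) \<longleftrightarrow> D \<in> rc_graphs (n + 1) (w_perm n)"
  (is "?E \<in> _ \<longleftrightarrow> _")
proof -
  have exits: "(\<forall>p\<in>{1..n + 2}. exits_at ?E p (w_perm (n + 1) p)) \<longleftrightarrow>
    (\<forall>p\<in>{1..n + 1}. exits_at D p (w_perm n p))"
  proof -
    have "exits_at ?E (Suc k) (w_perm (n + 1) (Suc k))"
      unfolding w_perm_new[OF k] by (rule new_strand_exits)
    moreover have "exits_at ?E (shift k p) (w_perm (n + 1) (shift k p)) \<longleftrightarrow>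
      exits_at D p (w_perm n p)" if "p \<in> {1..n + 1}" for p
      using that w_perm_shift[OF k] exits_at_insert_ear_iff by simp
    ultimately show ?thesis unfolding strand_numbers[OF k(2)] by blast
  qed
  have new: "card (crossings ?E (Suc k) (shift k q)) \<le> 1"
    if "\<forall>p\<in>{1..n + 2}. exits_at ?E p (w_perm (n + 1) p)" "q \<in> {1..n + 1}" for q
  proof (rule card_crossings_new_strand)
    have "shift k q \<in> {1..n + 2}" using that(2) unfolding strand_numbers[OF k(2)] by auto
    thus "1 \<le> shift k q" "exits_at ?E (shift k q) (w_perm (n + 1) (shift k q))"
      using that(1) by auto
    \<comment> \<open>From index 2 on the permutation decreases, so strands starting below row
      \<open>Suc k\<close> exit left of the new column.\<close>
    show "w_perm (n + 1) (shift k q) \<le> n + 2 - k" if "Suc k < shift k q"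
      using that \<open>shift k q \<in> {1..n + 2}\<close> by (auto simp: w_perm_def)
  qed simp
  show ?thesis
  proof
    assume E: "?E \<in> rc_graphs (n + 2) (w_perm (n + 1))"
    show "D \<in> rc_graphs (n + 1) (w_perm n)"
      unfolding rc_graphs_triangle
    proof (intro conjI ballI impI)
      show "D \<subseteq> triangle (n + 1)" by (rule D)
      show "exits_at D p (w_perm n p)" if "p \<in> {1..n + 1}" for p
        using E exits that unfolding rc_graphs_triangle by blast
      show "card (crossings D p q) \<le> 1"
        if "p \<in> {1..n + 1}" "q \<in> {1..n + 1}" "p \<noteq> q" for p q
      proof -
        have "shift k p \<in> {1..n + 2}" "shift k q \<in> {1..n + 2}" "shift k p \<noteq> shift k q"
          using that unfolding strand_numbers[OF k(2)] by auto
        with E have "card (crossings ?E (shift k p) (shift k q)) \<le> 1"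
          unfolding rc_graphs_triangle by blast
        thus ?thesis using card_crossings_insert_ear that by simp
      qed
    qed
  next
    assume D': "D \<in> rc_graphs (n + 1) (w_perm n)"
    hence ex: "\<forall>p\<in>{1..n + 2}. exits_at ?E p (w_perm (n + 1) p)"
      using exits unfolding rc_graphs_triangle by blast
    show "?E \<in> rc_graphs (n + 2) (w_perm (n + 1))"
      unfolding rc_graphs_triangle
    proof (intro conjI ballI impI)
      show "?E \<subseteq> triangle (n + 2)" by (rule insert_ear_triangle)
      show "exits_at ?E p (w_perm (n + 1) p)" if "p \<in> {1..n + 2}" for p
        using ex that by blast
      show "card (crossings ?E p q) \<le> 1"
        if pq: "p \<in> {1..n + 2}" "q \<in> {1..n + 2}" "p \<noteq> q" for p q
      proof -
        have old: "card (crossings D a b) \<le> 1"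
          if "a \<in> {1..n + 1}" "b \<in> {1..n + 1}" "a \<noteq> b" for a b
          using D' that unfolding rc_graphs_triangle by blast
        consider a b where "p = shift k a" "q = shift k b" "a \<in> {1..n + 1}" "b \<in> {1..n + 1}"
          | b where "p = Suc k" "q = shift k b" "b \<in> {1..n + 1}"
          | a where "p = shift k a" "q = Suc k" "a \<in> {1..n + 1}"
          using pq unfolding strand_numbers[OF k(2)] by blast
        thus ?thesis
        proof cases
          case 1
          thus ?thesis using card_crossings_insert_ear old pq(3) by simp
        next
          case 2
          thus ?thesis using new ex by simp
        next
          case 3
          thus ?thesis using new ex crossings_commute by metis
        qed
      qed
    qed
  qed
qed

text \<open>The inserted lines contribute only crosses inside the new triangle. Old anti-diagonal
  positions move to the new anti-diagonal, except the ear, where neither coordinate is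
  shifted.\<close>

lemma nontrivial_elbows_insert_ear:
  "nontrivial_elbows (n + 1) (insert_ear n k D) =
    insert (k, n + 2 - k) ((\<lambda>(i, j). (shift k i, shift (n + 2 - k) j)) ` nontrivial_elbows n D)"
  (is "?L = ?R")
proof (intro equalityI subsetI)
  fix x assume x: "x \<in> ?L"
  then obtain i j where ij: "x = (i, j)" "1 \<le> i" "1 \<le> j" "i + j \<le> n + 2"
    "(i, j) \<notin> insert_ear n k D" by (auto simp: nontrivial_elbows_def)
  have "i \<noteq> Suc k" "j \<noteq> Suc (n + 2 - k)" using ij insert_ear_iff(2,3) k by auto
  then obtain i' j' where ij': "i = shift k i'" "j = shift (n + 2 - k) j'"
    by (metis shift_cases)
  have "(i', j') \<notin> D" using ij ij' insert_ear_iff(1) by auto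
  moreover have "i' + j' \<le> n + 1 \<or> (i' = k \<and> j' = n + 2 - k)" "1 \<le> i'" "1 \<le> j'"
    using ij ij' k by (auto simp: shift_def split: if_splits)
  ultimately consider "(i', j') \<in> nontrivial_elbows n D" | "i' = k" "j' = n + 2 - k"
    by (auto simp: nontrivial_elbows_def)
  thus "x \<in> ?R"
  proof cases
    case 1
    thus ?thesis using ij(1) ij' by (intro insertI2 image_eqI[of _ _ "(i', j')"]) auto
  next
    case 2
    thus ?thesis using ij ij' by (simp add: shift_def)
  qed
next
  fix x assume "x \<in> ?R"
  moreover have "(k, n + 2 - k) \<notin> insert_ear n k D"
    using insert_ear_iff(1)[of k "n + 2 - k"] D k by (auto simp: shift_def triangle_def)
  hence "(k, n + 2 - k) \<in> ?L" using k by (auto simp: nontrivial_elbows_def)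
  moreover have "(shift k i, shift (n + 2 - k) j) \<in> ?L" if "(i, j) \<in> nontrivial_elbows n D" for i j
  proof -
    have "1 \<le> shift k i" "1 \<le> shift (n + 2 - k) j" "shift k i + shift (n + 2 - k) j \<le> n + 2"
      using that k by (auto simp: nontrivial_elbows_def shift_def)
    thus ?thesis using that insert_ear_iff(1) by (auto simp: nontrivial_elbows_def)
  qed
  ultimately show "x \<in> ?L" by auto
qed

end

subsection \<open>Existence of an ear\<close>

text \<open>With all rows below row \<open>k\<close> full of crosses, the strands entering row \<open>k\<close> from below are
  sorted decreasingly, and adjacent ones have already crossed each other.\<close>

lemma elbow_next_to_elbow:
  assumes D: "D \<in> rc_graphs m w"
    and below: "\<And>i j. k < i \<Longrightarrow> 1 \<le> j \<Longrightarrow> i + j \<le> m \<Longrightarrow> (i, j) \<in> D"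
    and j: "1 \<le> k" "1 \<le> j" "k + Suc j \<le> m" "(k, j) \<notin> D"
  shows "(k, Suc j) \<notin> D"
proof
  assume D': "(k, Suc j) \<in> D"
  have DT: "D \<subseteq> triangle m" using D by (simp add: rc_graphs_triangle)
  have column: "strand D p i c Bottom_Edge"
    if "p + c = Suc m" "1 \<le> c" "k \<le> i" "i < p" for p c i
  proof -
    have "strand D p p c Left_Edge"
      by (rule strand_along_row) (use that j below in auto)
    moreover have "(p, c) \<notin> D" using DT that by (auto simp: triangle_def)
    ultimately have "strand D p (p - 1) c Bottom_Edge"
      using strand.elbow_left_top[of D p "p - 1" c] that by simp
    thus ?thesis
      by (rule strand_along_column) (use that below in auto)
  qed
  \<comment> \<open>The strands that turn at the anti-diagonal and come up columns \<open>j\<close>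
    and \<open>Suc j\<close>. The elbow at \<open>(k, j)\<close> sends \<open>p\<close> to the
    right, into the supposed cross with \<open>q\<close>.\<close>
  define p q where "p = Suc m - j" and "q = m - j"
  have pq: "p + j = Suc m" "q + Suc j = Suc m" "q < p" "k < q" "p = Suc q"
    using j by (auto simp: p_def q_def)
  have "strand D p k j Bottom_Edge" using column[of p j k] pq j by simp
  with j have "strand D p k (Suc j) Left_Edge"
    using strand.elbow_bottom_right[of D p "k - 1" j] by simp
  moreover have "strand D q k (Suc j) Bottom_Edge" using column[of q "Suc j" k] pq j by simp
  ultimately have c1: "(k, Suc j) \<in> crossings D p q" using D' by (simp add: crossings_def)
  \<comment> \<open>The earlier crossing: while still running along its own row \<open>q\<close>,
    below row \<open>k\<close>, strand \<open>q\<close> meets \<open>p\<close> coming up column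
    \<open>j\<close>.\<close>
  have "strand D q q j Left_Edge"
    by (rule strand_along_row) (use j pq below in auto)
  moreover have "strand D p q j Bottom_Edge" using column[of p j q] pq j by simp
  moreover have "(q, j) \<in> D" using below pq j by auto
  ultimately have c2: "(q, j) \<in> crossings D p q" by (simp add: crossings_def)
  have "finite (crossings D p q)"
    using crossings_subset DT finite_triangle finite_subset by metis
  hence "card {(k, Suc j), (q, j)} \<le> card (crossings D p q)"
    by (rule card_mono) (use c1 c2 in auto)
  hence "2 \<le> card (crossings D p q)" by simp
  moreover have "card (crossings D p q) \<le> 1"
    using D pq j by (auto simp: rc_graphs_triangle)
  ultimately show False by simp
qed

text \<open>A cross would carry strand 1 into column 2, past its prescribed exit.\<close>

lemma rc_graph_corner:
  assumes "D \<in> rc_graphs (n + 1) (w_perm n)"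
  shows "(1, 1) \<notin> D"
proof
  assume "(1, 1) \<in> D"
  hence "strand D 1 1 2 Left_Edge"
    using strand.cross_horizontal[of D 1 0 1] strand.enter[of D 1] by (simp add: numeral_2_eq_2)
  moreover have "exits_at D 1 (w_perm n 1)"
    using assms unfolding rc_graphs_triangle by auto
  hence "exits_at D 1 1" by (simp add: w_perm_def)
  ultimately show False using strand_column_le_exit by force
qed

text \<open>The inverse of the insertion. The bound on the rows of the remaining elbows makes the
  ear's row recoverable from the row numbers alone.\<close>

lemma rc_graph_ear:
  assumes D: "D \<in> rc_graphs (n + 2) (w_perm (n + 1))"
  obtains k D' where "1 \<le> k" "k \<le> n + 1" "D' \<in> rc_graphs (n + 1) (w_perm n)"
    "D = insert_ear n k D'" "\<And>i j. (i, j) \<in> nontrivial_elbows n D' \<Longrightarrow> i \<le> k"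
proof -
  have DT: "D \<subseteq> triangle (n + 2)" using D by (simp add: rc_graphs_triangle)
  define A where "A = {i. \<exists>j. (i, j) \<in> nontrivial_elbows (n + 1) D}"
  have A: "A \<subseteq> {..n + 1}" by (auto simp: A_def nontrivial_elbows_def)
  hence finA: "finite A" by (rule finite_subset) simp
  \<comment> \<open>The corner elbow makes \<open>A\<close> nonempty, so a last row \<open>k\<close>
    with a nontrivial elbow exists.\<close>
  have "(1, 1) \<notin> D" using rc_graph_corner[of D "n + 1"] D by simp
  hence "1 \<in> A" by (auto simp: A_def nontrivial_elbows_def)
  define k where "k = Max A"
  have "k \<in> A" using Max_in[OF finA] \<open>1 \<in> A\<close> k_def by auto
  have kmax: "i \<le> k" if "i \<in> A" for i using that finA k_def by simp
  have k: "1 \<le> k" "k \<le> n + 1" using kmax[OF \<open>1 \<in> A\<close>] \<open>k \<in> A\<close> A by auto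
  have below: "(i, j) \<in> D" if "k < i" "1 \<le> j" "i + j \<le> n + 2" for i j
    using kmax[of i] that by (force simp: A_def nontrivial_elbows_def)
  obtain j0 where j0: "1 \<le> j0" "k + j0 \<le> n + 2" "(k, j0) \<notin> D"
    using \<open>k \<in> A\<close> by (auto simp: A_def nontrivial_elbows_def)
  have "j0 \<le> n + 2 - k" using j0 by simp
  \<comment> \<open>Elbows spread to the right along row \<open>k\<close>, up to its last nontrivial
    position.\<close>
  hence ear: "(k, n + 2 - k) \<notin> D"
  proof (rule dec_induct)
    show "(k, j0) \<notin> D" by (rule j0(3))
    show "(k, Suc j) \<notin> D" if "j0 \<le> j" "j < n + 2 - k" "(k, j) \<notin> D" for j
      by (rule elbow_next_to_elbow[OF D]) (use that j0 k below in auto)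
  qed
  have "strand D (Suc k) (Suc k) (n + 2 - k) Left_Edge"
    by (rule strand_along_row) (use k below in auto)
  moreover have "(Suc k, n + 2 - k) \<notin> D" using DT k by (auto simp: triangle_def)
  ultimately have "strand D (Suc k) k (n + 2 - k) Bottom_Edge" by (rule strand.elbow_left_top)
  with ear have "strand D (Suc k) k (Suc (n + 2 - k)) Left_Edge"
    using strand.elbow_bottom_right[of D "Suc k" "k - 1"] k by simp
  moreover have "(k, Suc (n + 2 - k)) \<notin> D" using DT k by (auto simp: triangle_def)
  ultimately have top: "strand D (Suc k) (k - 1) (Suc (n + 2 - k)) Bottom_Edge"
    using strand.elbow_left_top[of D "Suc k" "k - 1"] k by simp
  have exit: "exits_at D (Suc k) (Suc (n + 2 - k))"
    using D k unfolding rc_graphs_triangle w_perm_new[OF k, symmetric] by auto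
  \<comment> \<open>An elbow would turn strand \<open>Suc k\<close> to the right, beyond its exit
    column.\<close>
  have column_step: "(i, Suc (n + 2 - k)) \<in> D"
    if "1 \<le> i" "strand D (Suc k) i (Suc (n + 2 - k)) Bottom_Edge" for i
  proof (rule ccontr)
    assume "(i, Suc (n + 2 - k)) \<notin> D"
    with that have "strand D (Suc k) i (Suc (Suc (n + 2 - k))) Left_Edge"
      using strand.elbow_bottom_right[of D "Suc k" "i - 1"] by simp
    from strand_column_le_exit[OF this exit] that show False by simp
  qed
  have "strand D (Suc k) i (Suc (n + 2 - k)) Bottom_Edge" if "i \<le> k - 1" for i
    using that
  proof (induction i rule: inc_induct)
    case base
    show ?case by (rule top)
  next
    case (step i)
    thus ?case
      using column_step[of "Suc i"] strand.cross_vertical[of D "Suc k" i "Suc (n + 2 - k)"] by simp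
  qed
  hence column: "(i, Suc (n + 2 - k)) \<in> D" if "1 \<le> i" "i < k" for i
    using that column_step by simp
  define D' where "D' = {(i, j). (shift k i, shift (n + 2 - k) j) \<in> D}"
  have D'T: "D' \<subseteq> triangle (n + 1)"
  proof
    fix x assume "x \<in> D'"
    then obtain i j where x: "x = (i, j)" "(shift k i, shift (n + 2 - k) j) \<in> D"
      by (auto simp: D'_def)
    hence T: "1 \<le> shift k i" "1 \<le> shift (n + 2 - k) j"
      "shift k i + shift (n + 2 - k) j \<le> n + 2" using DT by (auto simp: triangle_def)
    \<comment> \<open>The ear is the only position of the new triangle that contraction would put on
      the old anti-diagonal; as an elbow, it is not in \<open>D\<close>.\<close>
    have "\<not> (i = k \<and> j = n + 2 - k)" using x ear by (auto simp: shift_def)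
    hence "1 \<le> i \<and> 1 \<le> j \<and> i + j \<le> n + 1"
      using T k by (auto simp: shift_def split: if_splits)
    thus "x \<in> triangle (n + 1)" using x by (simp add: triangle_def)
  qed
  have eq: "D = insert_ear n k D'"
  proof (intro equalityI subsetI)
    fix x assume x: "x \<in> D"
    obtain i j where ij: "x = (i, j)" by (cases x)
    have T: "1 \<le> i" "1 \<le> j" "i + j \<le> n + 2" using x ij DT by (auto simp: triangle_def)
    show "x \<in> insert_ear n k D'"
    proof (cases i rule: shift_cases[of _ k])
      case 1
      thus ?thesis using insert_ear_iff(2)[OF k D'T] T ij by simp
    next
      case i: (2 i')
      show ?thesis
      proof (cases j rule: shift_cases[of _ "n + 2 - k"])
        case 1
        thus ?thesis using insert_ear_iff(3)[OF k D'T, of i] T k ij by simp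
      next
        case (2 j')
        thus ?thesis using insert_ear_iff(1)[OF k D'T, of i' j'] i ij x by (simp add: D'_def)
      qed
    qed
  next
    fix x assume "x \<in> insert_ear n k D'"
    thus "x \<in> D" using column below by (auto simp: insert_ear_def D'_def)
  qed
  have rows: "i \<le> k" if "(i, j) \<in> nontrivial_elbows n D'" for i j
  proof (rule ccontr)
    assume "\<not> i \<le> k"
    have "(shift k i, shift (n + 2 - k) j) \<in> nontrivial_elbows (n + 1) D"
      using that nontrivial_elbows_insert_ear[OF k D'T] eq by force
    hence "shift k i \<in> A" by (auto simp: A_def)
    from kmax[OF this] \<open>\<not> i \<le> k\<close> show False by (auto simp: shift_def)
  qed
  have "D' \<in> rc_graphs (n + 1) (w_perm n)"
    using insert_ear_rc_graph_iff[OF k D'T] D eq by simp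
  with that k eq rows show ?thesis by blast
qed

subsection \<open>Rows of the elbows\<close>

definition elbow_rows :: "nat \<Rightarrow> (nat \<times> nat) set \<Rightarrow> nat multiset" where
  "elbow_rows n D =
    filter_mset (\<lambda>x. 0 < x) (image_mset (\<lambda>(i, j). i - 1) (mset_set (nontrivial_elbows n D)))"

lemma finite_nontrivial_elbows: "finite (nontrivial_elbows n D)"
  by (rule finite_subset[OF _ finite_triangle[of "n + 1"]])
    (auto simp: triangle_def nontrivial_elbows_def)

text \<open>All old elbows lie in rows up to \<open>k\<close>, which keep their numbers, so only the
  ear adds an entry. For \<open>k = 1\<close> this entry is 0 and the filter discards it.\<close>

lemma elbow_rows_insert_ear:
  assumes k: "1 \<le> k" "k \<le> n + 1" and D: "D \<subseteq> triangle (n + 1)"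
    and rows: "\<And>i j. (i, j) \<in> nontrivial_elbows n D \<Longrightarrow> i \<le> k"
  shows "elbow_rows (n + 1) (insert_ear n k D) =
    filter_mset (\<lambda>x. 0 < x) {#k - 1#} + elbow_rows n D"
proof -
  let ?f = "\<lambda>(i, j). (shift k i, shift (n + 2 - k) j)"
  let ?N = "nontrivial_elbows n D"
  have new: "(k, n + 2 - k) \<notin> ?f ` ?N"
  proof
    assume "(k, n + 2 - k) \<in> ?f ` ?N"
    then obtain i j where "(i, j) \<in> ?N" "shift k i = k" "shift (n + 2 - k) j = n + 2 - k"
      by auto
    moreover from this have "i + j \<le> n + 1" by (simp add: nontrivial_elbows_def)
    ultimately show False using k by (auto simp: shift_def split: if_splits)
  qed
  have "inj_on ?f ?N" by (auto simp: inj_on_def)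
  hence "mset_set (nontrivial_elbows (n + 1) (insert_ear n k D)) =
    add_mset (k, n + 2 - k) (image_mset ?f (mset_set ?N))"
    unfolding nontrivial_elbows_insert_ear[OF k D]
    using new finite_nontrivial_elbows by (simp add: image_mset_mset_set)
  moreover have "image_mset (\<lambda>x. case ?f x of (i, j) \<Rightarrow> i - 1) (mset_set ?N) =
    image_mset (\<lambda>(i, j). i - 1) (mset_set ?N)"
    by (rule image_mset_cong) (use rows finite_nontrivial_elbows in \<open>auto simp: shift_def\<close>)
  ultimately show ?thesis
    by (simp add: elbow_rows_def multiset.map_comp comp_def)
qed

text \<open>The multisets of parts of conjugates of members of \<open>DP n\<close>: the number of
  entries at least \<open>i\<close> is the \<open>i\<close>-th part of the partition.\<close>

definition staircase_multisets :: "nat \<Rightarrow> nat multiset set" where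
  "staircase_multisets n =
    {M. 0 \<notin># M \<and> (\<forall>i\<ge>1. size (filter_mset (\<lambda>x. i \<le> x) M) \<le> n - i)}"

text \<open>The multiset determines the ear's row \<open>Suc m\<close>. Inserting 0 before taking
  the maximum covers the empty multiset, where the ear lies in row 1.\<close>

lemma rc_graph_ear_rows:
  assumes D: "D \<in> rc_graphs (n + 2) (w_perm (n + 1))"
    and m: "m = Max (insert 0 (set_mset (elbow_rows (n + 1) D)))"
  obtains D' where "m \<le> n" "D' \<in> rc_graphs (n + 1) (w_perm n)" "D = insert_ear n (Suc m) D'"
    "elbow_rows n D' = elbow_rows (n + 1) D - {#m#}" "\<And>x. x \<in># elbow_rows n D' \<Longrightarrow> x \<le> m"
    "elbow_rows (n + 1) D = filter_mset (\<lambda>x. 0 < x) {#m#} + elbow_rows n D'"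
proof -
  obtain k D' where k: "1 \<le> k" "k \<le> n + 1" and D': "D' \<in> rc_graphs (n + 1) (w_perm n)"
    and eq: "D = insert_ear n k D'" and rows: "\<And>i j. (i, j) \<in> nontrivial_elbows n D' \<Longrightarrow> i \<le> k"
    using rc_graph_ear[OF D] by metis
  have D'T: "D' \<subseteq> triangle (n + 1)" using D' by (simp add: rc_graphs_triangle)
  have er: "elbow_rows (n + 1) D = filter_mset (\<lambda>x. 0 < x) {#k - 1#} + elbow_rows n D'"
    unfolding eq by (rule elbow_rows_insert_ear[OF k D'T rows])
  have le: "x \<le> k - 1" if "x \<in># elbow_rows n D'" for x
    using that rows finite_nontrivial_elbows by (fastforce simp: elbow_rows_def)
  have "m = k - 1"
    unfolding m
  proof (rule Max_eqI)
    show "y \<le> k - 1" if "y \<in> insert 0 (set_mset (elbow_rows (n + 1) D))" for y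
      using that le unfolding er by (auto split: if_splits)
    show "k - 1 \<in> insert 0 (set_mset (elbow_rows (n + 1) D))"
      unfolding er by simp
  qed simp
  hence km: "k = Suc m" using k by simp
  have "0 \<notin># elbow_rows n D'" by (simp add: elbow_rows_def)
  \<comment> \<open>For \<open>m = 0\<close> the subtraction removes nothing, as 0 never
    occurs.\<close>
  hence "elbow_rows n D' = elbow_rows (n + 1) D - {#m#}"
    unfolding er using km by (cases "m = 0") (auto simp: diff_single_trivial)
  with that k D' eq er le km show ?thesis by auto
qed

section \<open>The bijection between rc-graphs and staircase multisets\<close>

lemma rc_graphs_0: "rc_graphs 1 (w_perm 0) = {{}}"
proof -
  have "exits_at {} 1 1"
    unfolding exits_at_def using strand.elbow_left_top[of "{}" 1 0 1] strand.enter[of "{}" 1]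
    by simp
  moreover have "triangle 1 = {}" by (auto simp: triangle_def)
  ultimately show ?thesis by (auto simp: rc_graphs_triangle w_perm_def)
qed

lemma staircase_multisets_0: "staircase_multisets 0 = {{#}}"
proof -
  have "M = {#}" if "M \<in> staircase_multisets 0" for M
  proof (rule ccontr)
    assume "M \<noteq> {#}"
    then obtain x where "x \<in># M" by blast
    with that have "filter_mset (\<lambda>x. 1 \<le> x) M = {#}" "1 \<le> x"
      by (auto simp: staircase_multisets_def Suc_le_eq intro: gr0I)
    with \<open>x \<in># M\<close> show False by (auto simp: filter_mset_eq_mempty_iff)
  qed
  thus ?thesis by (auto simp: staircase_multisets_def)
qed

lemma bij_betw_elbow_rows:
  "bij_betw (elbow_rows n) (rc_graphs (n + 1) (w_perm n)) (staircase_multisets n)"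
proof (induction n)
  case 0
  have "elbow_rows 0 {} = {#}"
    using finite_nontrivial_elbows[of 0 "{}"]
    by (auto simp: elbow_rows_def nontrivial_elbows_def filter_mset_eq_mempty_iff)
  thus ?case using rc_graphs_0 staircase_multisets_0 by (simp add: bij_betw_def)
next
  case (Suc n)
  have inj: "inj_on (elbow_rows n) (rc_graphs (n + 1) (w_perm n))"
    and image: "elbow_rows n ` rc_graphs (n + 1) (w_perm n) = staircase_multisets n"
    using Suc by (simp_all add: bij_betw_def)
  let ?max = "\<lambda>M. Max (insert 0 (set_mset M))"
  have "bij_betw (elbow_rows (n + 1)) (rc_graphs (n + 2) (w_perm (n + 1)))
    (staircase_multisets (n + 1))"
  proof (rule bij_betw_imageI)
    show "inj_on (elbow_rows (n + 1)) (rc_graphs (n + 2) (w_perm (n + 1)))"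
    proof (rule inj_onI)
      fix D E assume D: "D \<in> rc_graphs (n + 2) (w_perm (n + 1))"
        and E: "E \<in> rc_graphs (n + 2) (w_perm (n + 1))"
        and eq: "elbow_rows (n + 1) D = elbow_rows (n + 1) E"
      define m where "m = ?max (elbow_rows (n + 1) D)"
      obtain D' where D': "D' \<in> rc_graphs (n + 1) (w_perm n)" "D = insert_ear n (Suc m) D'"
        "elbow_rows n D' = elbow_rows (n + 1) D - {#m#}"
        using rc_graph_ear_rows[OF D m_def] by metis
      obtain E' where E': "E' \<in> rc_graphs (n + 1) (w_perm n)" "E = insert_ear n (Suc m) E'"
        "elbow_rows n E' = elbow_rows (n + 1) D - {#m#}"
        using rc_graph_ear_rows[OF E m_def[unfolded eq]] eq by metis
      \<comment> \<open>Equal multisets give the same \<open>m\<close> and the same remainder, so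
        the induction hypothesis identifies the smaller rc-graphs.\<close>
      have "D' = E'" using inj_onD[OF inj _ D'(1) E'(1)] D'(3) E'(3) by simp
      thus "D = E" using D' E' by simp
    qed
    show "elbow_rows (n + 1) ` rc_graphs (n + 2) (w_perm (n + 1)) = staircase_multisets (n + 1)"
    proof (intro equalityI subsetI)
      fix M assume "M \<in> elbow_rows (n + 1) ` rc_graphs (n + 2) (w_perm (n + 1))"
      then obtain D where D: "D \<in> rc_graphs (n + 2) (w_perm (n + 1))"
        and M: "M = elbow_rows (n + 1) D" by blast
      define m where "m = ?max (elbow_rows (n + 1) D)"
      obtain D' where "m \<le> n" and D': "D' \<in> rc_graphs (n + 1) (w_perm n)"
        and er: "elbow_rows (n + 1) D = filter_mset (\<lambda>x. 0 < x) {#m#} + elbow_rows n D'"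
        using rc_graph_ear_rows[OF D m_def] by metis
      have "elbow_rows n D' \<in> staircase_multisets n" using image D' by blast
      hence "0 \<notin># elbow_rows n D'"
        and sz: "\<And>i. 1 \<le> i \<Longrightarrow> size (filter_mset (\<lambda>x. i \<le> x) (elbow_rows n D')) \<le> n - i"
        by (auto simp: staircase_multisets_def)
      \<comment> \<open>The entry \<open>m\<close> is counted only if
        \<open>i \<le> m \<le> n\<close>, and then the bound has also grown by one.\<close>
      moreover have "size (filter_mset (\<lambda>x. i \<le> x) M) \<le> n + 1 - i" if "1 \<le> i" for i
        using sz[OF that] \<open>m \<le> n\<close> that unfolding M er by auto
      ultimately show "M \<in> staircase_multisets (n + 1)"
        unfolding staircase_multisets_def M er by auto
    next
      fix M assume M: "M \<in> staircase_multisets (n + 1)"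
      define m where "m = ?max M"
      have M0: "0 \<notin># M"
        and sz: "\<And>i. 1 \<le> i \<Longrightarrow> size (filter_mset (\<lambda>x. i \<le> x) M) \<le> n + 1 - i"
        using M by (auto simp: staircase_multisets_def)
      have le: "x \<le> m" if "x \<in># M" for x using that by (simp add: m_def)
      have "m \<in> insert 0 (set_mset M)" unfolding m_def by (rule Max_in) auto
      hence mM: "m \<in># M" if "1 \<le> m" using that by auto
      \<comment> \<open>A positive maximum is counted among the entries at least \<open>m\<close>,
        so \<open>n + 1 - m\<close> cannot be 0.\<close>
      have "m \<le> n"
      proof (rule ccontr)
        assume "\<not> m \<le> n"
        hence "m \<in># filter_mset (\<lambda>x. m \<le> x) M" using mM by simp
        hence "0 < size (filter_mset (\<lambda>x. m \<le> x) M)"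
          by (metis empty_iff nonempty_has_size set_mset_empty)
        moreover have "size (filter_mset (\<lambda>x. m \<le> x) M) \<le> n + 1 - m"
          by (rule sz) (use \<open>\<not> m \<le> n\<close> in simp)
        ultimately show False using \<open>\<not> m \<le> n\<close> by linarith
      qed
      define M' where "M' = M - {#m#}"
      have split: "M = filter_mset (\<lambda>x. 0 < x) {#m#} + M'"
        unfolding M'_def using M0 mM by (cases "m = 0") (auto simp: diff_single_trivial)
      have "M' \<in> staircase_multisets n"
        unfolding staircase_multisets_def
      proof (intro CollectI conjI allI impI)
        show "0 \<notin># M'" using M0 unfolding M'_def by (meson in_diffD)
        show "size (filter_mset (\<lambda>x. i \<le> x) M') \<le> n - i" if "1 \<le> i" for i
        \<comment> \<open>For \<open>i \<le> m\<close> the removed maximum lowers the count by one;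
          for larger \<open>i\<close> nothing is counted.\<close>
        proof (cases "i \<le> m")
          case True
          have "filter_mset (\<lambda>x. i \<le> x) M = add_mset m (filter_mset (\<lambda>x. i \<le> x) M')"
            using True that by (subst split) simp
          hence "size (filter_mset (\<lambda>x. i \<le> x) M) = Suc (size (filter_mset (\<lambda>x. i \<le> x) M'))"
            by simp
          with sz[OF that] True \<open>m \<le> n\<close> show ?thesis by linarith
        next
          case False
          have "x \<le> m" if "x \<in># M'" for x
            using le in_diffD that unfolding M'_def by metis
          with False have "filter_mset (\<lambda>x. i \<le> x) M' = {#}" by fastforce
          thus ?thesis by (metis size_empty le0)
        qed
      qed
      then obtain D' where D': "D' \<in> rc_graphs (n + 1) (w_perm n)" "elbow_rows n D' = M'"
        using image by (metis (no_types, lifting) image_iff)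
      have D'T: "D' \<subseteq> triangle (n + 1)" using D' by (simp add: rc_graphs_triangle)
      \<comment> \<open>An elbow below row \<open>Suc m\<close> would give \<open>M\<close> an entry
        above its maximum.\<close>
      have rows: "i \<le> Suc m" if ij: "(i, j) \<in> nontrivial_elbows n D'" for i j
      proof (rule ccontr)
        assume "\<not> i \<le> Suc m"
        hence "i - 1 \<in># elbow_rows n D'"
          using ij finite_nontrivial_elbows by (force simp: elbow_rows_def)
        hence "i - 1 \<in># M" using D'(2) unfolding M'_def by (metis in_diffD)
        from le[OF this] \<open>\<not> i \<le> Suc m\<close> show False by simp
      qed
      have k: "1 \<le> Suc m" "Suc m \<le> n + 1" using \<open>m \<le> n\<close> by auto
      have "elbow_rows (n + 1) (insert_ear n (Suc m) D') = M"
        using elbow_rows_insert_ear[OF k D'T rows] D'(2) split by simp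
      moreover have "insert_ear n (Suc m) D' \<in> rc_graphs (n + 2) (w_perm (n + 1))"
        using insert_ear_rc_graph_iff[OF k D'T] D' by simp
      ultimately show "M \<in> elbow_rows (n + 1) ` rc_graphs (n + 2) (w_perm (n + 1))" by blast
    qed
  qed
  thus ?case by simp
qed

subsection \<open>Conjugation of partitions\<close>

lemma part_antimono:
  assumes "is_partition xs" "1 \<le> k" "k \<le> k'"
  shows "part xs k' \<le> part xs k"
proof (cases "k < k' \<and> k' \<le> length xs")
  case True
  hence "xs ! (k' - 1) \<le> xs ! (k - 1)"
    using assms sorted_wrt_nth_less[of "(\<ge>)" xs "k - 1" "k' - 1"] by (auto simp: is_partition_def)
  with True assms show ?thesis by (simp add: part_def)
next
  case False
  thus ?thesis using assms by (cases "k = k'") (auto simp: part_def)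
qed

lemma part_positive_iff:
  assumes "is_partition xs" "1 \<le> k"
  shows "0 < part xs k \<longleftrightarrow> k \<le> length xs"
  using assms by (auto simp: part_def is_partition_def)

lemma partition_eqI:
  assumes "is_partition xs" "is_partition ys" "\<And>k. 1 \<le> k \<Longrightarrow> part xs k = part ys k"
  shows "xs = ys"
proof -
  have len: "k \<le> length xs \<longleftrightarrow> k \<le> length ys" if "1 \<le> k" for k
    using part_positive_iff[of xs k] part_positive_iff[of ys k] assms that by simp
  have "length xs = length ys"
    using len[of "length xs"] len[of "length ys"] by (cases "length xs"; cases "length ys") auto
  moreover have "xs ! i = ys ! i" if "i < length xs" for i
    using assms(3)[of "Suc i"] that \<open>length xs = length ys\<close> by (simp add: part_def)
  ultimately show ?thesis by (rule nth_equalityI)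
qed

text \<open>Parts decrease, so the indices whose part is at least \<open>v\<close> form an initial
  segment. Both sides say that the cell in row \<open>k\<close> and column \<open>v\<close> belongs
  to the Young diagram.\<close>

lemma length_filter_part:
  assumes "is_partition xs" "1 \<le> v" "1 \<le> k"
  shows "k \<le> length (filter (\<lambda>x. v \<le> x) xs) \<longleftrightarrow> v \<le> part xs k"
proof -
  have "length (filter (\<lambda>x. v \<le> x) xs) = card {i. i < length xs \<and> v \<le> xs ! i}"
    by (rule length_filter_conv_card)
  also have "{i. i < length xs \<and> v \<le> xs ! i} = {i. v \<le> part xs (Suc i)}"
    using assms by (auto simp: part_def)
  finally have len: "length (filter (\<lambda>x. v \<le> x) xs) = card {i. v \<le> part xs (Suc i)}" .
  have fin: "finite {i. v \<le> part xs (Suc i)}"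
    by (rule finite_subset[of _ "{..<length xs}"]) (use assms in \<open>auto simp: part_def split: if_splits\<close>)
  show ?thesis
  proof
    assume "v \<le> part xs k"
    have "{..<k} \<subseteq> {i. v \<le> part xs (Suc i)}"
    proof
      fix i assume "i \<in> {..<k}"
      hence "part xs k \<le> part xs (Suc i)" using part_antimono[OF assms(1), of "Suc i" k] by simp
      with \<open>v \<le> part xs k\<close> show "i \<in> {i. v \<le> part xs (Suc i)}" by simp
    qed
    from card_mono[OF fin this] show "k \<le> length (filter (\<lambda>x. v \<le> x) xs)" using len by simp
  next
    assume k: "k \<le> length (filter (\<lambda>x. v \<le> x) xs)"
    show "v \<le> part xs k"
    proof (rule ccontr)
      assume "\<not> v \<le> part xs k"
      have "{i. v \<le> part xs (Suc i)} \<subseteq> {..<k - 1}"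
      proof
        fix i assume "i \<in> {i. v \<le> part xs (Suc i)}"
        with \<open>\<not> v \<le> part xs k\<close> have "\<not> part xs (Suc i) \<le> part xs k" by simp
        hence "\<not> k \<le> Suc i" using part_antimono[OF assms(1,3)] by blast
        thus "i \<in> {..<k - 1}" by simp
      qed
      from card_mono[OF _ this] k assms len show False by simp
    qed
  qed
qed

lemma part_conjugate:
  assumes "is_partition xs" "1 \<le> k"
  shows "part (conjugate xs) k = length (filter (\<lambda>x. k \<le> x) xs)"
proof (cases "k \<le> part xs 1")
  case True
  hence "[1..<Suc (part xs 1)] ! (k - 1) = k" using assms by (subst nth_upt) auto
  hence "conjugate xs ! (k - 1) = length (filter (\<lambda>x. k \<le> x) xs)"
    using True assms by (simp add: conjugate_def del: upt_Suc One_nat_def)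
  moreover have "length (conjugate xs) = part xs 1" by (simp add: conjugate_def del: upt_Suc)
  hence "part (conjugate xs) k = conjugate xs ! (k - 1)"
    using True assms by (simp add: part_def[of "conjugate xs"])
  ultimately show ?thesis by simp
next
  case False
  hence "\<not> 1 \<le> length (filter (\<lambda>x. k \<le> x) xs)"
    using length_filter_part[of xs k 1] assms by simp
  hence "length (filter (\<lambda>x. k \<le> x) xs) = 0" by linarith
  with False show ?thesis by (simp add: part_def conjugate_def del: upt_Suc)
qed

lemma is_partition_conjugate:
  assumes "is_partition xs"
  shows "is_partition (conjugate xs)"
  unfolding is_partition_def
proof
  have "length (filter (\<lambda>x. k' \<le> x) xs) \<le> length (filter (\<lambda>x. k \<le> x) xs)" if "k \<le> k'" for k k'
    using that by (induction xs) auto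
  thus "sorted_wrt (\<ge>) (conjugate xs)"
    by (auto simp: conjugate_def sorted_wrt_iff_nth_less simp del: upt_Suc)
  have "1 \<le> length (filter (\<lambda>x. k \<le> x) xs)" if "1 \<le> k" "k \<le> part xs 1" for k
    using length_filter_part[of xs k 1] that assms by simp
  thus "\<forall>x\<in>set (conjugate xs). 0 < x"
    by (force simp: conjugate_def simp del: upt_Suc)
qed

text \<open>Transposing a cell twice returns it, so both \<open>k\<close>-th parts dominate the same
  positive numbers \<open>v\<close>; taking \<open>v\<close> to be either part gives
  equality.\<close>

lemma conjugate_conjugate:
  assumes "is_partition xs"
  shows "conjugate (conjugate xs) = xs"
proof (rule partition_eqI)
  have c: "is_partition (conjugate xs)" by (rule is_partition_conjugate[OF assms])
  show "is_partition (conjugate (conjugate xs))" by (rule is_partition_conjugate[OF c])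
  show "is_partition xs" by (rule assms)
  fix k :: nat assume k: "1 \<le> k"
  have "v \<le> part (conjugate (conjugate xs)) k \<longleftrightarrow> v \<le> part xs k" if "1 \<le> v" for v
    using part_conjugate[OF c k] length_filter_part[OF c k that] part_conjugate[OF assms that]
      length_filter_part[OF assms that k] by simp
  from this[of "part xs k"] this[of "part (conjugate (conjugate xs)) k"]
  show "part (conjugate (conjugate xs)) k = part xs k"
    by (cases "part xs k"; cases "part (conjugate (conjugate xs)) k") auto
qed

section \<open>Partitions in the staircase and their multisets\<close>

lemma partition_mset_unique:
  assumes "is_partition xs" "is_partition ys" "mset xs = mset ys"
  shows "xs = ys"
proof -
  have "sorted (rev xs)" "sorted (rev ys)"
    using assms by (auto simp: is_partition_def sorted_wrt_rev)
  moreover have "mset (rev xs) = mset (rev ys)" using assms by simp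
  ultimately have "rev xs = rev ys" by (metis properties_for_sort)
  thus ?thesis by simp
qed

lemma ex_partition_of_mset:
  assumes "0 \<notin># M"
  obtains xs where "is_partition xs" "mset xs = M"
proof
  have "sorted_wrt (\<ge>) (rev (sorted_list_of_multiset M))"
    using sorted_sorted_list_of_multiset[of M] by (simp add: sorted_wrt_rev)
  thus "is_partition (rev (sorted_list_of_multiset M))"
    using assms by (auto simp: is_partition_def intro: gr0I)
qed simp

lemma DP_iff:
  assumes "n \<ge> 1"
  shows "xs \<in> DP n \<longleftrightarrow> is_partition xs \<and> (\<forall>k\<ge>1. part xs k \<le> n - k)"
proof
  assume xs: "xs \<in> DP n"
  have "part xs k \<le> n - k" if "1 \<le> k" for k
    using xs that by (cases "k \<le> n") (auto simp: DP_def part_def)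
  with xs show "is_partition xs \<and> (\<forall>k\<ge>1. part xs k \<le> n - k)" by (simp add: DP_def)
next
  assume xs: "is_partition xs \<and> (\<forall>k\<ge>1. part xs k \<le> n - k)"
  \<comment> \<open>At index \<open>n\<close> the bound is 0, so the \<open>n\<close>-th part
    vanishes, which bounds the length.\<close>
  hence "part xs n \<le> n - n" using assms by blast
  hence "length xs \<le> n - 1" using part_positive_iff[of xs n] xs assms by simp
  with xs show "xs \<in> DP n" by (simp add: DP_def)
qed

text \<open>Counting the parts of the conjugate that are at least \<open>k\<close> gives the
  \<open>k\<close>-th part of the double conjugate, which is \<open>xs\<close>.\<close>

lemma size_filter_conjugate:
  assumes "is_partition xs" "1 \<le> k"
  shows "size (filter_mset (\<lambda>x. k \<le> x) (mset (conjugate xs))) = part xs k"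
  using part_conjugate[OF is_partition_conjugate[OF assms(1)] assms(2)]
  by (simp add: conjugate_conjugate[OF assms(1)] flip: mset_filter)

lemma mset_conjugate_inject:
  assumes "is_partition xs" "is_partition ys" "mset (conjugate xs) = mset (conjugate ys)"
  shows "xs = ys"
  using assms partition_mset_unique is_partition_conjugate conjugate_conjugate by metis

lemma bij_betw_mset_conjugate:
  assumes "n \<ge> 1"
  shows "bij_betw (\<lambda>xs. mset (conjugate xs)) (DP n) (staircase_multisets n)"
proof (rule bij_betw_imageI)
  show "inj_on (\<lambda>xs. mset (conjugate xs)) (DP n)"
    using mset_conjugate_inject by (auto simp: inj_on_def DP_def)
  show "(\<lambda>xs. mset (conjugate xs)) ` DP n = staircase_multisets n"
  proof (intro equalityI subsetI)
    fix M assume "M \<in> (\<lambda>xs. mset (conjugate xs)) ` DP n"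
    then obtain xs where xs: "is_partition xs" "\<forall>k\<ge>1. part xs k \<le> n - k"
      "M = mset (conjugate xs)"
      using DP_iff[OF assms] by blast
    have "0 \<notin># M" using is_partition_conjugate[OF xs(1)] xs(3) by (auto simp: is_partition_def)
    with xs size_filter_conjugate show "M \<in> staircase_multisets n"
      by (auto simp: staircase_multisets_def)
  next
    fix M assume M: "M \<in> staircase_multisets n"
    then obtain ys where ys: "is_partition ys" "mset ys = M"
      using ex_partition_of_mset by (auto simp: staircase_multisets_def)
    \<comment> \<open>The preimage of \<open>M\<close> is the conjugate of \<open>M\<close> sorted
      decreasingly.\<close>
    have xs: "is_partition (conjugate ys)" "mset (conjugate (conjugate ys)) = M"
      using ys is_partition_conjugate conjugate_conjugate by auto
    moreover have "part (conjugate ys) k \<le> n - k" if "1 \<le> k" for k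
      using size_filter_conjugate[OF xs(1) that] xs(2) M that
      by (auto simp: staircase_multisets_def)
    ultimately show "M \<in> (\<lambda>xs. mset (conjugate xs)) ` DP n"
      unfolding DP_iff[OF assms] image_iff
      by (intro bexI[of _ "conjugate ys"]) (auto simp: DP_iff[OF assms])
  qed
qed

theorem proposition2:
  fixes n :: nat
  assumes "n \<ge> 1"
  shows "bij_betw (rc_partition n) (rc_graphs (n + 1) (w_perm n)) (DP n)"
proof -
  let ?c = "\<lambda>xs. mset (conjugate xs)"
  have c: "bij_betw ?c (DP n) (staircase_multisets n)" by (rule bij_betw_mset_conjugate[OF assms])
  \<comment> \<open>On rc-graphs the description by \<open>THE\<close> is \<open>elbow_rows\<close>
    followed by the inverse of the conjugation bijection.\<close>
  have "rc_partition n D = (the_inv_into (DP n) ?c \<circ> elbow_rows n) D"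
    if "D \<in> rc_graphs (n + 1) (w_perm n)" for D
  proof -
    have "elbow_rows n D \<in> ?c ` DP n"
      using that bij_betw_elbow_rows[of n] c by (auto simp: bij_betw_def)
    then obtain xs where xs: "xs \<in> DP n" "?c xs = elbow_rows n D" by auto
    have "rc_partition n D = xs"
      unfolding rc_partition_def elbow_rows_def[symmetric]
    proof (rule the_equality)
      show "is_partition xs \<and> ?c xs = elbow_rows n D" using xs by (simp add: DP_def)
      \<comment> \<open>Here \<open>ys\<close> ranges over all partitions, not only over
        \<open>DP n\<close>, so injectivity on all partitions is used.\<close>
      show "ys = xs" if "is_partition ys \<and> ?c ys = elbow_rows n D" for ys
        using that xs mset_conjugate_inject by (auto simp: DP_def)
    qed
    moreover have "the_inv_into (DP n) ?c (elbow_rows n D) = xs"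
      by (rule the_inv_into_f_eq[OF bij_betw_imp_inj_on[OF c] xs(2,1)])
    ultimately show ?thesis by simp
  qed
  moreover have "bij_betw (the_inv_into (DP n) ?c \<circ> elbow_rows n)
    (rc_graphs (n + 1) (w_perm n)) (DP n)"
    by (rule bij_betw_trans[OF bij_betw_elbow_rows bij_betw_the_inv_into[OF c]])
  ultimately show ?thesis using bij_betw_cong by blast
qed

end
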